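(* Let $g_{ab}$ be a Lorentzian metric of signature $(-+++)$ and $T_{ab}$ a real symmetric tensor at a spacetime point. In a fixed orthonormal tetrad $\{n^a,e_1^a,e_2^a,e_3^a\}$ with $n^a$ timelike, let $\widehat T$ be the $4\times4$ symmetric matrix of tetrad components of $T_{ab}$, let $\eta=\mathrm{diag}(-1,1,1,1)$, and let $M(\sigma)=\widehat T+\sigma\eta$ for $\sigma\in\mathbb{R}$. For $s\in\mathbb{R}^3$ with $|s|=1$ write $k^a=n^a+s^ie_i^a$. Then $$2\max_{\sigma\in\mathbb{R}}\lambda_{\min}\bigl(M(\sigma)\bigr)=\min_{|s|=1}T_{ab}k^ak^b,$$ and the maximum over $\sigma$ is attained.
   Context: Orthonormal tetrad: $g_{ab}n^an^b=-1$, $g_{ab}n^ae_i^b=0$, $g_{ab}e_i^ae_j^b=\delta_{ij}$. The components are $\widehat T_{00}=T_{ab}n^an^b$, $\widehat T_{0i}=\widehat T_{i0}=T_{ab}n^ae_i^b$, $\widehat T_{ij}=T_{ab}e_i^ae_j^b$. $\lambda_{\min}(A)$ denotes the smallest eigenvalue of the real symmetric matrix $A$. No hypothesis is made on the algebraic type of $T^a{}_b$. *)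

theory Defs
  imports "HOL-Analysis.Analysis"
begin

definition symmetric_tensor :: "('v::real_vector \<Rightarrow> 'v \<Rightarrow> real) \<Rightarrow> bool" where
  "symmetric_tensor T \<longleftrightarrow> bilinear T \<and> (\<forall>u v. T u v = T v u)"

(* Index 0 :: 4 is the time index. Matrices indexed by type 4 have the rows 0, 1, 2, 3 (with 4 = 0). *)
definition eta :: "real ^ 4 ^ 4" where
  "eta = (\<chi> \<mu> \<nu>. if \<mu> \<noteq> \<nu> then 0 else if \<mu> = 0 then - 1 else 1)"

(* Signature (-+++): some basis, indexed by the four-element type 4, diagonalises g to eta.
   The tangent space 'v is thereby forced to be four-dimensional. *)
definition lorentzian :: "('v::real_vector \<Rightarrow> 'v \<Rightarrow> real) \<Rightarrow> bool" where
  "lorentzian g \<longleftrightarrow> symmetric_tensor g \<and>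
     (\<exists>b :: 4 \<Rightarrow> 'v. inj b \<and> independent (range b) \<and> span (range b) = UNIV \<and>
        (\<forall>\<mu> \<nu>. g (b \<mu>) (b \<nu>) = eta $ \<mu> $ \<nu>))"

definition orthonormal_tetrad ::
  "('v::real_vector \<Rightarrow> 'v \<Rightarrow> real) \<Rightarrow> 'v \<Rightarrow> (3 \<Rightarrow> 'v) \<Rightarrow> bool" where
  "orthonormal_tetrad g n e \<longleftrightarrow>
     g n n = - 1 \<and> (\<forall>i. g n (e i) = 0) \<and>
     (\<forall>i j. g (e i) (e j) = (if i = j then 1 else 0))"

definition tetrad_vector :: "'v \<Rightarrow> (3 \<Rightarrow> 'v) \<Rightarrow> 4 \<Rightarrow> 'v" where
  "tetrad_vector n e \<mu> =
     (if \<mu> = 0 then n else if \<mu> = 1 then e 1 else if \<mu> = 2 then e 2 else e 3)"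

definition tetrad_components ::
  "('v::real_vector \<Rightarrow> 'v \<Rightarrow> real) \<Rightarrow> 'v \<Rightarrow> (3 \<Rightarrow> 'v) \<Rightarrow> real ^ 4 ^ 4" where
  "tetrad_components T n e = (\<chi> \<mu> \<nu>. T (tetrad_vector n e \<mu>) (tetrad_vector n e \<nu>))"

definition real_eigenvalue :: "real ^ 'n ^ 'n \<Rightarrow> real \<Rightarrow> bool" where
  "real_eigenvalue A l \<longleftrightarrow> (\<exists>v. v \<noteq> 0 \<and> A *v v = l *\<^sub>R v)"

(* Meaningful for symmetric A, which has at least one and only finitely many real eigenvalues. *)
definition lambda_min :: "real ^ 'n ^ 'n \<Rightarrow> real" where
  "lambda_min A = (LEAST l. real_eigenvalue A l)"

definition null_vector :: "'v::real_vector \<Rightarrow> (3 \<Rightarrow> 'v) \<Rightarrow> real ^ 3 \<Rightarrow> 'v" where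
  "null_vector n e s = n + (\<Sum>i\<in>UNIV. s $ i *\<^sub>R e i)"

end

theory Submission
  imports Defs
begin

text \<open>
  Since \<^term>\<open>lambda_min\<close> is the minimum of the Rayleigh quotient and a null vector \<open>(1, s)\<close> with
  \<open>|s| = 1\<close> has squared Euclidean norm 2 and does not see the term \<open>\<sigma> \<eta>\<close>, twice the smallest
  eigenvalue of \<open>M(\<sigma>)\<close> never exceeds the minimum \<open>m\<close> of \<open>T\<close> on null vectors. Conversely
  \<open>T - (m/2) I\<close> is nonnegative on the null cone of the indefinite form \<open>\<eta>\<close>, so by the S-lemma (with an
  equality constraint) some \<open>\<sigma>\<close> makes \<open>T + \<sigma> \<eta> - (m/2) I\<close> positive semidefinite. This \<open>\<sigma>\<close> attains
  the maximum.
\<close>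

section \<open>The S-lemma\<close>

lemma symmetric_tensor_add_scaleR:
  assumes "symmetric_tensor R"
  shows "R (u + c *\<^sub>R v) (u + c *\<^sub>R v) = R u u + 2 * c * R u v + c\<^sup>2 * R v v"
proof -
  have "bilinear R" "R v u = R u v"
    using assms by (auto simp: symmetric_tensor_def)
  then show ?thesis
    by (simp add: bilinear_ladd bilinear_radd bilinear_lmul bilinear_rmul power2_eq_square
        algebra_simps)
qed

lemma symmetric_tensor_diff_scaled:
  assumes "symmetric_tensor R" "symmetric_tensor S"
  shows "symmetric_tensor (\<lambda>x y. R x y - c * S x y)"
  using assms by (auto simp: symmetric_tensor_def bilinear_def linear_iff algebra_simps)

text \<open>With \<open>c = x / d\<close> the equation becomes
  \<open>(x + b)^2 = b^2 - a * d\<close>. Since \<open>a * d < 0\<close>, the root \<open>r\<close>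
  of the right side exceeds \<open>\<bar>b\<bar>\<close>, which fixes both signs.\<close>

lemma quadratic_roots_opposite_sign:
  fixes a b d :: real
  assumes "a > 0" "d < 0"
  obtains c1 c2 where "c1 > 0" "c2 < 0" "a + 2 * c1 * b + c1\<^sup>2 * d = 0"
    "a + 2 * c2 * b + c2\<^sup>2 * d = 0" "c1 * c2 = a / d"
proof -
  define r where "r = sqrt (b\<^sup>2 - a * d)"
  have ad: "a * d < 0"
    using assms by (simp add: mult_pos_neg)
  have r2: "r\<^sup>2 = b\<^sup>2 - a * d"
    unfolding r_def using ad by (intro real_sqrt_pow2) (smt (verit) zero_le_power2)
  have "\<bar>b\<bar> < r"
    unfolding r_def using ad by (intro real_less_rsqrt) auto
  then have rb: "b + r > 0" "b - r < 0"
    by auto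
  have root: "a + 2 * (x / d) * b + (x / d)\<^sup>2 * d = 0" if "(x + b)\<^sup>2 = r\<^sup>2" for x
  proof -
    have "a * d + 2 * x * b + x\<^sup>2 = 0"
      using that r2 by (simp add: power2_eq_square algebra_simps)
    moreover have "a + 2 * (x / d) * b + (x / d)\<^sup>2 * d = (a * d + 2 * x * b + x\<^sup>2) / d"
      using assms by (simp add: field_simps power2_eq_square)
    ultimately show ?thesis
      by simp
  qed
  show ?thesis
  proof
    show "(- b - r) / d > 0" "(- b + r) / d < 0"
      using rb assms by (auto simp: divide_neg_neg divide_pos_neg)
    show "a + 2 * ((- b - r) / d) * b + ((- b - r) / d)\<^sup>2 * d = 0"
      by (rule root) simp
    show "a + 2 * ((- b + r) / d) * b + ((- b + r) / d)\<^sup>2 * d = 0"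
      by (rule root) simp
    have "(- b - r) * (- b + r) = a * d"
      using r2 by (simp add: power2_eq_square algebra_simps)
    then show "(- b - r) / d * ((- b + r) / d) = a / d"
      using assms by (simp add: field_simps)
  qed
qed

text \<open>The line through \<open>u\<close> in direction \<open>v\<close> meets the null cone of \<open>H\<close> on both sides of \<open>u\<close>; a suitable
  positive combination of the two resulting inequalities eliminates the mixed term \<open>R u v\<close>.\<close>

lemma S_lemma_two_vectors:
  assumes R: "symmetric_tensor R" and H: "symmetric_tensor H"
    and nonneg: "\<And>w. H w w = 0 \<Longrightarrow> 0 \<le> R w w"
    and u: "H u u > 0" and v: "H v v < 0"
  shows "- R u u / H u u \<le> R v v / (- H v v)"
proof -
  obtain c1 c2 where c: "c1 > 0" "c2 < 0"
    and "H u u + 2 * c1 * H u v + c1\<^sup>2 * H v v = 0" "H u u + 2 * c2 * H u v + c2\<^sup>2 * H v v = 0"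
    and prod: "c1 * c2 = H u u / H v v"
    using quadratic_roots_opposite_sign[OF u v] by metis
  then have "0 \<le> R u u + 2 * c1 * R u v + c1\<^sup>2 * R v v" "0 \<le> R u u + 2 * c2 * R u v + c2\<^sup>2 * R v v"
    using nonneg[of "u + c1 *\<^sub>R v"] nonneg[of "u + c2 *\<^sub>R v"]
    by (simp_all add: symmetric_tensor_add_scaleR[OF R] symmetric_tensor_add_scaleR[OF H])
  then have "0 \<le> (- c2) * (R u u + 2 * c1 * R u v + c1\<^sup>2 * R v v)
      + c1 * (R u u + 2 * c2 * R u v + c2\<^sup>2 * R v v)"
    using c by (intro add_nonneg_nonneg[OF mult_nonneg_nonneg mult_nonneg_nonneg]) auto
  also have "\<dots> = (c1 - c2) * (R u u - c1 * c2 * R v v)"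
    by (simp add: power2_eq_square algebra_simps)
  finally have "0 \<le> R u u - H u u / H v v * R v v"
    using c unfolding prod by (simp add: zero_le_mult_iff)
  then have "0 \<le> (R u u - H u u / H v v * R v v) / H u u"
    using u by simp
  also have "\<dots> = R u u / H u u - R v v / H v v"
    using u v by (simp add: field_simps)
  finally show ?thesis
    by simp
qed

text \<open>Vectors with \<open>H u u > 0\<close> bound \<sigma> from below, those with
  \<open>H v v < 0\<close> from above. By \<open>S_lemma_two_vectors\<close> every lower bound is at
  most every upper bound, so the supremum of the lower bounds works; \<open>u\<^sub>0\<close> and
  \<open>v\<^sub>0\<close> make it a real number.\<close>

lemma S_lemma_equality:
  assumes R: "symmetric_tensor R" and H: "symmetric_tensor H"
    and nonneg: "\<And>w. H w w = 0 \<Longrightarrow> 0 \<le> R w w"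
    and pos: "H u\<^sub>0 u\<^sub>0 > 0" and neg: "H v\<^sub>0 v\<^sub>0 < 0"
  obtains \<sigma> where "\<And>x. 0 \<le> R x x + \<sigma> * H x x"
proof
  define S where "S = (\<lambda>u. - R u u / H u u) ` {u. H u u > 0}"
  note le = S_lemma_two_vectors[OF R H nonneg]
  have ne: "S \<noteq> {}"
    using pos by (auto simp: S_def)
  have bdd: "bdd_above S"
    unfolding S_def by (rule bdd_aboveI2[where M = "R v\<^sub>0 v\<^sub>0 / (- H v\<^sub>0 v\<^sub>0)"]) (use le neg in auto)
  show "0 \<le> R x x + Sup S * H x x" for x
  proof (cases "H x x" "0 :: real" rule: linorder_cases)
    case less
    have "Sup S \<le> R x x / (- H x x)"
      by (rule cSup_least[OF ne]) (use le less in \<open>auto simp: S_def\<close>)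
    then show ?thesis
      using less by (simp add: field_simps)
  next
    case equal
    then show ?thesis
      using nonneg by simp
  next
    case greater
    have "- R x x / H x x \<le> Sup S"
      by (rule cSup_upper[OF _ bdd]) (use greater in \<open>auto simp: S_def\<close>)
    then show ?thesis
      using greater by (simp add: field_simps)
  qed
qed

section \<open>The smallest eigenvalue\<close>

lemma symmetric_tensor_matrix:
  fixes A :: "real ^ 'n ^ 'n"
  assumes "transpose A = A"
  shows "symmetric_tensor (\<lambda>x y. x \<bullet> (A *v y))"
proof -
  have "x \<bullet> (A *v y) = y \<bullet> (A *v x)" for x y
    by (metis assms dot_lmul_matrix inner_commute vector_transpose_matrix)
  then show ?thesis
    by (auto simp: symmetric_tensor_def bilinear_def linear_iff inner_add_left inner_add_right
        matrix_vector_right_distrib matrix_vector_mult_scaleR)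
qed

text \<open>A zero \<open>v\<close> of the nonnegative form \<open>B\<close> minimises it, so its
  first variation vanishes. Moving from \<open>v\<close> against the residual \<open>w\<close> would
  make \<open>B\<close> negative unless \<open>w = 0\<close>.\<close>

lemma psd_kernel:
  fixes A :: "real ^ 'n ^ 'n"
  assumes A: "transpose A = A" and psd: "\<And>x. l * (x \<bullet> x) \<le> x \<bullet> (A *v x)"
    and v: "v \<bullet> (A *v v) = l * (v \<bullet> v)"
  shows "A *v v = l *\<^sub>R v"
proof -
  define B where "B = (\<lambda>x y. x \<bullet> (A *v y) - l * (x \<bullet> y))"
  define w where "w = A *v v - l *\<^sub>R v"
  have inner: "symmetric_tensor (\<lambda>x y :: real ^ 'n. x \<bullet> y)"
    using symmetric_tensor_matrix[of "mat 1 :: real ^ 'n ^ 'n"] by simp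
  have B: "symmetric_tensor B"
    unfolding B_def by (intro symmetric_tensor_diff_scaled symmetric_tensor_matrix A inner)
  have Bvw: "B v w = w \<bullet> w"
    using B by (simp add: symmetric_tensor_def) (simp add: B_def w_def inner_diff_right)
  have Bww: "0 \<le> B w w" and Bvv: "B v v = 0"
    using psd v by (auto simp: B_def)
  \<comment> \<open>Nearly the minimiser of \<open>- 2 * t * (w \<bullet> w) + t^2 * B w w\<close>;
    the added 1 keeps the denominator positive when \<open>B w w = 0\<close>.\<close>
  define t where "t = (w \<bullet> w) / (B w w + 1)"
  have "0 \<le> B (v + (- t) *\<^sub>R w) (v + (- t) *\<^sub>R w)"
    using psd by (simp only: B_def) (simp add: diff_ge_0_iff_ge)
  also have "\<dots> = - 2 * t * (w \<bullet> w) + t\<^sup>2 * B w w"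
    unfolding symmetric_tensor_add_scaleR[OF B] by (simp add: Bvw Bvv)
  also have "\<dots> \<le> - 2 * t * (w \<bullet> w) + t\<^sup>2 * (B w w + 1)"
    by (simp add: mult_left_mono)
  also have "t\<^sup>2 * (B w w + 1) = t * (w \<bullet> w)"
    using Bww by (simp add: t_def power2_eq_square)
  finally have "t * (w \<bullet> w) \<le> 0"
    by simp
  then have "(w \<bullet> w)\<^sup>2 / (B w w + 1) \<le> 0"
    by (simp add: t_def power2_eq_square)
  then have "w \<bullet> w = 0"
    using Bww by (simp add: divide_le_0_iff)
  then show ?thesis
    by (simp add: w_def)
qed

lemma lambda_min_eqI:
  fixes A :: "real ^ 'n ^ 'n"
  assumes A: "transpose A = A" and psd: "\<And>x. l * (x \<bullet> x) \<le> x \<bullet> (A *v x)"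
    and v: "v \<noteq> 0" "v \<bullet> (A *v v) = l * (v \<bullet> v)"
  shows "lambda_min A = l"
  unfolding lambda_min_def
proof (rule Least_equality)
  show "real_eigenvalue A l"
    unfolding real_eigenvalue_def using psd_kernel[OF A psd v(2)] v(1) by blast
  fix k assume "real_eigenvalue A k"
  then obtain x where "x \<noteq> 0" "A *v x = k *\<^sub>R x"
    by (auto simp: real_eigenvalue_def)
  then show "l \<le> k"
    using psd[of x] by simp
qed

text \<open>By compactness the quadratic form attains its minimum on the unit sphere, homogeneity
  extends the bound to all vectors, and \<open>lambda_min_eqI\<close> identifies the minimum with
  \<open>lambda_min A\<close>.\<close>

lemma lambda_min_Rayleigh:
  fixes A :: "real ^ 'n ^ 'n"
  assumes A: "transpose A = A"
  shows "lambda_min A * (x \<bullet> x) \<le> x \<bullet> (A *v x)"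
proof -
  have "continuous_on (sphere 0 1) (\<lambda>x :: real ^ 'n. x \<bullet> (A *v x))"
    by (intro continuous_intros linear_continuous_on matrix_vector_mul_bounded_linear)
  then obtain v :: "real ^ 'n" where v: "norm v = 1"
    and min: "\<And>y. norm y = 1 \<Longrightarrow> v \<bullet> (A *v v) \<le> y \<bullet> (A *v y)"
    using continuous_attains_inf[of "sphere 0 1 :: (real ^ 'n) set" "\<lambda>x. x \<bullet> (A *v x)"] by auto
  have psd: "v \<bullet> (A *v v) * (y \<bullet> y) \<le> y \<bullet> (A *v y)" for y
  proof (cases "y = 0")
    case False
    have "v \<bullet> (A *v v) \<le> (y /\<^sub>R norm y) \<bullet> (A *v (y /\<^sub>R norm y))"
      by (rule min) (use False in simp)
    also have "\<dots> = y \<bullet> (A *v y) / (y \<bullet> y)"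
      by (simp add: matrix_vector_mult_scaleR dot_square_norm power2_eq_square field_simps)
    finally show ?thesis
      using False by (simp add: field_simps)
  qed simp
  have "lambda_min A = v \<bullet> (A *v v)"
    by (rule lambda_min_eqI[OF A psd, of v]) (use v in \<open>auto simp: dot_square_norm\<close>)
  then show ?thesis
    using psd by simp
qed

section \<open>Tetrad components\<close>

lemma tetrad_components_form:
  assumes "bilinear T"
  shows "x \<bullet> (tetrad_components T n e *v y) =
    T (\<Sum>\<mu>\<in>UNIV. x $ \<mu> *\<^sub>R tetrad_vector n e \<mu>) (\<Sum>\<nu>\<in>UNIV. y $ \<nu> *\<^sub>R tetrad_vector n e \<nu>)"
proof -
  have "T (\<Sum>\<mu>\<in>UNIV. x $ \<mu> *\<^sub>R tetrad_vector n e \<mu>) (\<Sum>\<nu>\<in>UNIV. y $ \<nu> *\<^sub>R tetrad_vector n e \<nu>) =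
    (\<Sum>\<mu>\<in>UNIV. \<Sum>\<nu>\<in>UNIV. x $ \<mu> * (y $ \<nu> * T (tetrad_vector n e \<mu>) (tetrad_vector n e \<nu>)))"
    by (simp add: bilinear_sum[OF assms] sum.cartesian_product bilinear_lmul[OF assms]
        bilinear_rmul[OF assms] mult.left_commute)
  then show ?thesis
    by (simp add: inner_vec_def matrix_vector_mult_def tetrad_components_def sum_distrib_left
        mult_ac)
qed

text \<open>Library facts enumerate type \<open>4\<close> as 1, 2, 3, 4; here the time index is
  written 0.\<close>

lemma four_eq_zero: "(4 :: 4) = 0"
  by simp

lemma exhaust_4_zero: "\<mu> = 0 \<or> \<mu> = 1 \<or> \<mu> = 2 \<or> \<mu> = 3" for \<mu> :: 4
  using exhaust_4[of \<mu>] unfolding four_eq_zero by blast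

lemma sum_4_zero: "sum f (UNIV :: 4 set) = f 0 + f 1 + f 2 + f 3"
  unfolding sum_4 four_eq_zero by (simp only: add_ac)

lemma transpose_eta: "transpose eta = eta"
  by (simp add: transpose_def eta_def vec_eq_iff)

lemma eta_form: "x \<bullet> (eta *v x) = - (x $ 0)\<^sup>2 + (x $ 1)\<^sup>2 + (x $ 2)\<^sup>2 + (x $ 3)\<^sup>2"
  by (simp add: inner_vec_def matrix_vector_mult_def sum_4_zero eta_def power2_eq_square)

definition null_coords :: "real ^ 3 \<Rightarrow> real ^ 4" where
  \<comment> \<open>A sum of axis vectors, so that \<open>continuous_intros\<close> yields
    continuity in \<open>s\<close>.\<close>
  "null_coords s = axis 0 1 + s $ 1 *\<^sub>R axis 1 1 + s $ 2 *\<^sub>R axis 2 1 + s $ 3 *\<^sub>R axis 3 1"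

lemma null_coords_nth [simp]:
  "null_coords s $ 0 = 1" "null_coords s $ 1 = s $ 1"
  "null_coords s $ 2 = s $ 2" "null_coords s $ 3 = s $ 3"
  by (simp_all add: null_coords_def axis_def)

lemma null_vector_eq:
  "null_vector n e s = (\<Sum>\<mu>\<in>UNIV. null_coords s $ \<mu> *\<^sub>R tetrad_vector n e \<mu>)"
  by (simp add: null_vector_def sum_4_zero sum_3 tetrad_vector_def)

lemma inner_4: "x \<bullet> x = (x $ 0)\<^sup>2 + (x $ 1)\<^sup>2 + (x $ 2)\<^sup>2 + (x $ 3)\<^sup>2" for x :: "real ^ 4"
  by (simp add: inner_vec_def sum_4_zero power2_eq_square)

lemma norm_3_eq_1: "norm s = 1 \<longleftrightarrow> (s $ 1)\<^sup>2 + (s $ 2)\<^sup>2 + (s $ 3)\<^sup>2 = 1" for s :: "real ^ 3"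
  by (simp add: norm_eq_1 inner_vec_def sum_3 power2_eq_square)

text \<open>Dividing by \<open>x $ 0\<close> normalises a nonzero null vector; \<open>t\<close> may
  be negative, which covers both halves of the cone.\<close>

lemma null_cone_cases:
  assumes "x \<bullet> (eta *v x) = 0"
  obtains "x = 0" | t s where "norm s = 1" "x = t *\<^sub>R null_coords s"
proof (cases "x $ 0 = 0")
  case True
  then have "x \<bullet> x = 0"
    using assms by (simp add: eta_form inner_4)
  then show ?thesis
    using that(1) by simp
next
  case False
  define s :: "real ^ 3" where "s = vector [x $ 1 / x $ 0, x $ 2 / x $ 0, x $ 3 / x $ 0]"
  have "(x $ 1)\<^sup>2 + (x $ 2)\<^sup>2 + (x $ 3)\<^sup>2 = (x $ 0)\<^sup>2"
    using assms by (simp add: eta_form)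
  then have "norm s = 1"
    using False by (simp add: norm_3_eq_1 s_def power_divide flip: add_divide_distrib)
  moreover have "x $ \<mu> = (x $ 0 *\<^sub>R null_coords s) $ \<mu>" for \<mu>
    using exhaust_4_zero[of \<mu>] False by (auto simp: s_def)
  ultimately show ?thesis
    using that(2) by (metis vec_eq_iff)
qed

theorem corollary2:
  fixes g T :: "'v::real_vector \<Rightarrow> 'v \<Rightarrow> real"
    and n :: 'v and e :: "3 \<Rightarrow> 'v"
    and M :: "real \<Rightarrow> real ^ 4 ^ 4" and k :: "real ^ 3 \<Rightarrow> 'v"
  assumes "lorentzian g"
    and "symmetric_tensor T"
    and "orthonormal_tetrad g n e"
  defines "M \<equiv> \<lambda>\<sigma>. tetrad_components T n e + \<sigma> *\<^sub>R eta"
    and "k \<equiv> null_vector n e"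
  shows "\<exists>\<sigma>\<^sub>0 s\<^sub>0.
           (\<forall>\<sigma>. lambda_min (M \<sigma>) \<le> lambda_min (M \<sigma>\<^sub>0)) \<and>
           norm s\<^sub>0 = 1 \<and> (\<forall>s. norm s = 1 \<longrightarrow> T (k s\<^sub>0) (k s\<^sub>0) \<le> T (k s) (k s)) \<and>
           2 * lambda_min (M \<sigma>\<^sub>0) = T (k s\<^sub>0) (k s\<^sub>0)"
proof -
  define A where "A = tetrad_components T n e"
  define q where "q = (\<lambda>s. null_coords s \<bullet> (A *v null_coords s))"
  have Tk: "T (k s) (k s) = q s" for s
    using assms(2) unfolding q_def A_def k_def null_vector_eq symmetric_tensor_def
    by (simp add: tetrad_components_form)
  have A: "transpose A = A"
    using assms(2) by (simp add: A_def tetrad_components_def transpose_def vec_eq_iff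
        symmetric_tensor_def)
  have M: "transpose (M \<sigma>) = M \<sigma>" for \<sigma>
    using A transpose_eta by (simp add: M_def A_def transpose_def vec_eq_iff)
  have M_form: "x \<bullet> (M \<sigma> *v x) = x \<bullet> (A *v x) + \<sigma> * (x \<bullet> (eta *v x))" for \<sigma> x
    by (simp add: M_def A_def matrix_vector_mult_add_rdistrib inner_add_right
        scaleR_matrix_vector_assoc[symmetric])
  have null: "null_coords s \<bullet> (eta *v null_coords s) = 0"
    and norm2: "null_coords s \<bullet> null_coords s = 2" if "norm s = 1" for s
    using that by (simp_all add: eta_form inner_4 norm_3_eq_1)
  have "continuous_on (sphere 0 1) q"
    unfolding q_def null_coords_def
    by (intro continuous_intros bounded_linear.continuous_on[OF matrix_vector_mul_bounded_linear])
  then obtain s\<^sub>0 where s0: "norm s\<^sub>0 = 1" and min: "\<And>s. norm s = 1 \<Longrightarrow> q s\<^sub>0 \<le> q s"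
    using continuous_attains_inf[of "sphere 0 1" q] by auto
  \<comment> \<open>The factor 1/2 compensates the squared norm 2 of \<open>null_coords s\<close>;
    \<open>mat 1\<close> puts the inner product in the form required by
    \<open>symmetric_tensor_matrix\<close>.\<close>
  define R where "R = (\<lambda>x y. x \<bullet> (A *v y) - q s\<^sub>0 / 2 * (x \<bullet> (mat 1 *v y)))"
  have "symmetric_tensor R"
    unfolding R_def by (intro symmetric_tensor_diff_scaled symmetric_tensor_matrix A) simp
  moreover have "0 \<le> R x x" if "x \<bullet> (eta *v x) = 0" for x
    using that
  proof (cases rule: null_cone_cases)
    case (2 t s)
    have "R x x = t\<^sup>2 * (q s - q s\<^sub>0)"
      using norm2[OF 2(1)] unfolding R_def 2(2) q_def
      by (simp add: matrix_vector_mult_scaleR power2_eq_square algebra_simps)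
    then show ?thesis
      using min[OF 2(1)] by simp
  qed (simp add: R_def)
  moreover have "axis 1 1 \<bullet> (eta *v axis 1 1) > 0" "axis 0 1 \<bullet> (eta *v axis 0 1) < 0"
    by (simp_all add: eta_form axis_def)
  ultimately obtain \<sigma>\<^sub>0 where "\<And>x. 0 \<le> R x x + \<sigma>\<^sub>0 * (x \<bullet> (eta *v x))"
    using S_lemma_equality[OF _ symmetric_tensor_matrix[OF transpose_eta]] by metis
  then have "q s\<^sub>0 / 2 * (x \<bullet> x) \<le> x \<bullet> (M \<sigma>\<^sub>0 *v x)" for x
    unfolding M_form R_def by (smt (verit) matrix_vector_mul_lid)
  moreover have "null_coords s\<^sub>0 \<noteq> 0"
    using norm2[OF s0] by auto
  \<comment> \<open>The lower bound is an equality at \<open>null_coords s\<^sub>0\<close>, where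
    the \<open>eta\<close> term vanishes.\<close>
  ultimately have max: "lambda_min (M \<sigma>\<^sub>0) = q s\<^sub>0 / 2"
    using null[OF s0] norm2[OF s0]
    by (intro lambda_min_eqI[OF M, where v = "null_coords s\<^sub>0"]) (auto simp: M_form q_def)
  \<comment> \<open>The same null vector tests every \<sigma>, giving
    \<open>2 * lambda_min (M \<sigma>) \<le> q s\<^sub>0\<close>.\<close>
  have "lambda_min (M \<sigma>) \<le> lambda_min (M \<sigma>\<^sub>0)" for \<sigma>
    using lambda_min_Rayleigh[OF M, of \<sigma> "null_coords s\<^sub>0"] null[OF s0] norm2[OF s0]
    unfolding max by (simp add: M_form q_def)
  moreover have "2 * lambda_min (M \<sigma>\<^sub>0) = q s\<^sub>0"
    using max by simp
  ultimately show ?thesis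
    unfolding Tk using s0 min by blast
qed

end
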